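(* Let $a>0$ and let the plane $\mathbb{R}^2$ be endowed with the double Gaussian density $$f(x,y)=\frac{1}{4\pi a^2}e^{-y^2/(2a^2)}\left(e^{-(x-1)^2/(2a^2)}+e^{-(x+1)^2/(2a^2)}\right).$$ Then vertical lines enclose given area with less perimeter than horizontal lines: for every $0<A<1$, if a half-plane bounded by a vertical line $\ell_v$ and a half-plane bounded by a horizontal line $\ell_h$ both have weighted area $A$, then the weighted perimeter of $\ell_v$ is strictly less than the weighted perimeter of $\ell_h$.
   Context: The weighted area of a region $R\subset\mathbb{R}^2$ is $\iint_R f\,dx\,dy$ (the total weighted area of the plane is $1$), and the weighted perimeter of a curve $C$ is $\int_C f\,ds$, where $ds$ is arc length. A vertical line has the form $x=b$; a horizontal line has the form $y=c$. *)

theory Defs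
  imports "HOL-Analysis.Analysis"
begin

definition double_gaussian :: "real \<Rightarrow> real \<times> real \<Rightarrow> real" where
  "double_gaussian a = (\<lambda>(x, y).
     1 / (4 * pi * a\<^sup>2) * exp (- y\<^sup>2 / (2 * a\<^sup>2)) *
     (exp (- (x - 1)\<^sup>2 / (2 * a\<^sup>2)) + exp (- (x + 1)\<^sup>2 / (2 * a\<^sup>2))))"

definition weighted_area :: "(real \<times> real \<Rightarrow> real) \<Rightarrow> (real \<times> real) set \<Rightarrow> ennreal" where
  "weighted_area f R = (\<integral>\<^sup>+p\<in>R. ennreal (f p) \<partial>lborel)"

text \<open>Injectivity means that every point of the curve is traversed exactly once; a closed curve
  is parametrized on a half-open interval. Derivatives at endpoints of the interval are one-sided.\<close>

definition regular_parametrization ::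
  "real set \<Rightarrow> (real \<Rightarrow> real \<times> real) \<Rightarrow> (real \<Rightarrow> real \<times> real) \<Rightarrow> (real \<times> real) set \<Rightarrow> bool" where
  "regular_parametrization I \<gamma> \<gamma>' C \<longleftrightarrow>
     is_interval I \<and> inj_on \<gamma> I \<and> \<gamma> ` I = C \<and>
     (\<forall>t\<in>I. (\<gamma> has_vector_derivative \<gamma>' t) (at t within I) \<and> \<gamma>' t \<noteq> 0) \<and>
     continuous_on I \<gamma>'"

text \<open>The integral of \<open>f\<close> over \<open>C\<close> with respect to arc length, for a curve \<open>C\<close> that has a regular
  parametrization. The value does not depend on the parametrization, which is what makes the
  definite description meaningful.\<close>

definition weighted_perimeter :: "(real \<times> real \<Rightarrow> real) \<Rightarrow> (real \<times> real) set \<Rightarrow> ennreal" where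
  "weighted_perimeter f C =
     (THE P. \<exists>I \<gamma> \<gamma>'. regular_parametrization I \<gamma> \<gamma>' C \<and>
        P = (\<integral>\<^sup>+t\<in>I. ennreal (f (\<gamma> t) * norm (\<gamma>' t)) \<partial>lborel))"

definition vertical_line :: "real \<Rightarrow> (real \<times> real) set" where
  "vertical_line b = {(x, y). x = b}"

definition horizontal_line :: "real \<Rightarrow> (real \<times> real) set" where
  "horizontal_line c = {(x, y). y = c}"

text \<open>Open and closed half-planes, on either side of the bounding line.\<close>

definition half_plane_bounded_by :: "(real \<times> real) set \<Rightarrow> (real \<times> real) set \<Rightarrow> bool" where
  "half_plane_bounded_by H l \<longleftrightarrow>
     (\<exists>v d. v \<noteq> 0 \<and> (H = {p. v \<bullet> p \<le> d} \<or> H = {p. v \<bullet> p < d})) \<and> frontier H = l"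

end

theory Submission
  imports Defs "HOL-Probability.Distributions"
begin

text \<open>The density is the product of the average of two normal densities in \<open>x\<close>, with means \<open>1\<close> and
  \<open>- 1\<close>, and a centered normal density in \<open>y\<close>. Let \<open>I\<close> be the isoperimetric profile of the centered
  Gaussian on the line for half-lines, that is, its density as a function of its distribution function \<open>F\<close>.
  After a reflection a horizontal line at height \<open>c\<close> encloses area \<open>F c\<close> with perimeter \<open>I (F c)\<close>, while
  the vertical line at \<open>b\<close> encloses the average of \<open>F (b - 1)\<close> and \<open>F (b + 1)\<close> with the average of
  \<open>I (F (b - 1))\<close> and \<open>I (F (b + 1))\<close> as perimeter. Since \<open>I\<close> is strictly concave, the vertical line wins.\<close>

section \<open>Arc length integrals over straight lines\<close>

text \<open>The signed coordinate along the line turns any regular parametrization into a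
  differentiable bijection from \<open>I\<close> onto the reals, with speed
  \<open>norm (\<gamma>' t)\<close>. Change of variables then always yields \<open>L\<close>, which
  is the uniqueness that the definite description of the perimeter needs.\<close>

lemma nn_integral_regular_parametrization_line:
  fixes f :: "real \<times> real \<Rightarrow> real" and p d :: "real \<times> real"
  assumes d: "norm d = 1"
    and f: "\<And>q. 0 \<le> f q"
    and int: "((\<lambda>s. f (p + s *\<^sub>R d)) has_integral L) UNIV"
    and reg: "regular_parametrization I \<gamma> \<gamma>' (range (\<lambda>s. p + s *\<^sub>R d))"
  shows "(\<integral>\<^sup>+t\<in>I. ennreal (f (\<gamma> t) * norm (\<gamma>' t)) \<partial>lborel) = ennreal L"
proof -
  have I: "is_interval I" and inj: "inj_on \<gamma> I" and im: "\<gamma> ` I = range (\<lambda>s. p + s *\<^sub>R d)"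
    and der: "\<And>t. t \<in> I \<Longrightarrow> (\<gamma> has_vector_derivative \<gamma>' t) (at t within I)"
    using reg by (auto simp: regular_parametrization_def)
  have dd: "d \<bullet> d = 1"
    using d by (simp add: dot_square_norm)
  define u where "u t = (\<gamma> t - p) \<bullet> d" for t
  have g: "\<gamma> t = p + u t *\<^sub>R d" if t: "t \<in> I" for t
  proof -
    obtain s where "\<gamma> t = p + s *\<^sub>R d" using im t by blast
    then show ?thesis by (simp add: u_def dd)
  qed
  have uim: "u ` I = UNIV"
  proof -
    have "\<exists>t\<in>I. u t = s" for s
    proof -
      have "p + s *\<^sub>R d \<in> \<gamma> ` I" using im by blast
      then obtain t where "t \<in> I" "\<gamma> t = p + s *\<^sub>R d" by force
      then show ?thesis by (intro bexI[of _ t]) (auto simp: u_def dd)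
    qed
    then show ?thesis by (auto simp: image_iff eq_commute)
  qed
  have uinj: "inj_on u I"
    using inj g by (metis (no_types, lifting) inj_on_def)
  have du: "(u has_field_derivative \<gamma>' t \<bullet> d) (at t within I)" if t: "t \<in> I" for t
  proof -
    have "((\<lambda>t. (\<gamma> t - p) \<bullet> d) has_vector_derivative (\<gamma>' t - 0) \<bullet> d) (at t within I)"
      by (rule bounded_linear.has_vector_derivative[OF bounded_linear_inner_left])
         (intro derivative_intros der t)
    then show ?thesis
      by (simp add: u_def[abs_def] has_real_derivative_iff_has_vector_derivative)
  qed
  \<comment> \<open>On a one-point interval the filter \<open>at t within I\<close> is trivial and
    derivatives are not unique; this rules that case out.\<close>
  have not_single: "I \<noteq> {x}" for x
  proof
    assume "I = {x}"
    then have "UNIV = {u x}" using uim by simp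
    then show False
      by (metis UNIV_I singletonD zero_neq_one)
  qed
  have g': "norm (\<gamma>' t) = \<bar>\<gamma>' t \<bullet> d\<bar>" if t: "t \<in> I" for t
  proof -
    have "t islimpt I"
      by (rule connected_imp_perfect[OF is_interval_connected[OF I] t not_single])
    then have nb: "at t within I \<noteq> bot"
      by (simp add: trivial_limit_within)
    \<comment> \<open>Differentiating the curve through its coordinate \<open>u\<close> gives a
      multiple of \<open>d\<close>, so uniqueness of derivatives makes \<open>\<gamma>' t\<close>
      parallel to \<open>d\<close>.\<close>
    have "((\<lambda>t. p + u t *\<^sub>R d) has_vector_derivative (0 + (\<gamma>' t \<bullet> d) *\<^sub>R d)) (at t within I)"
      by (auto intro!: derivative_eq_intros du[OF t])
    then have "(\<gamma> has_vector_derivative (\<gamma>' t \<bullet> d) *\<^sub>R d) (at t within I)"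
      using has_vector_derivative_transform[OF t, of \<gamma> "\<lambda>t. p + u t *\<^sub>R d"] g by auto
    then have "\<gamma>' t = (\<gamma>' t \<bullet> d) *\<^sub>R d"
      using vector_derivative_unique_within[OF nb der[OF t]] by blast
    then have "norm (\<gamma>' t) = norm ((\<gamma>' t \<bullet> d) *\<^sub>R d)"
      by (rule arg_cong)
    then show ?thesis
      by (simp add: d)
  qed
  have meas: "I \<in> sets lebesgue"
    by (rule sets_completionI_sets) (simp add: real_interval_borel_measurable[OF I])
  \<comment> \<open>Nonnegativity of \<open>f\<close> upgrades integrability to absolute
    integrability; the change of variables theorem transfers it together with the value.\<close>
  have "(\<lambda>s. f (p + s *\<^sub>R d)) absolutely_integrable_on (u ` I) \<and> integral (u ` I) (\<lambda>s. f (p + s *\<^sub>R d)) = L"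
    unfolding uim using int f
    by (auto simp: absolutely_integrable_on_iff_nonneg has_integral_iff)
  then have "(\<lambda>t. \<bar>\<gamma>' t \<bullet> d\<bar> * f (p + u t *\<^sub>R d)) absolutely_integrable_on I
      \<and> integral I (\<lambda>t. \<bar>\<gamma>' t \<bullet> d\<bar> * f (p + u t *\<^sub>R d)) = L"
    by (subst has_absolute_integral_change_of_variables_1'[OF meas du uinj])
  then have "((\<lambda>t. \<bar>\<gamma>' t \<bullet> d\<bar> * f (p + u t *\<^sub>R d)) has_integral L) I"
    using absolutely_integrable_on_def has_integral_iff by blast
  then have "((\<lambda>t. f (\<gamma> t) * norm (\<gamma>' t)) has_integral L) I"
    by (rule has_integral_eq[rotated]) (simp add: g' g[symmetric] mult.commute)
  then show ?thesis
    by (intro nn_integral_has_integral_lebesgue') (auto simp: f)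
qed

text \<open>Existence comes from the unit-speed parametrization on \<open>UNIV\<close>, uniqueness
  from the preceding lemma.\<close>

lemma weighted_perimeter_line:
  fixes f :: "real \<times> real \<Rightarrow> real" and p d :: "real \<times> real"
  assumes d: "norm d = 1"
    and f: "\<And>q. 0 \<le> f q"
    and int: "((\<lambda>s. f (p + s *\<^sub>R d)) has_integral L) UNIV"
  shows "weighted_perimeter f (range (\<lambda>s. p + s *\<^sub>R d)) = ennreal L"
proof -
  have "d \<noteq> 0" using d by auto
  then have reg: "regular_parametrization UNIV (\<lambda>s. p + s *\<^sub>R d) (\<lambda>_. d) (range (\<lambda>s. p + s *\<^sub>R d))"
    unfolding regular_parametrization_def
    by (auto intro!: inj_onI derivative_eq_intros)
  show ?thesis
    unfolding weighted_perimeter_def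
  proof (rule the_equality)
    show "\<exists>I \<gamma> \<gamma>'. regular_parametrization I \<gamma> \<gamma>' (range (\<lambda>s. p + s *\<^sub>R d)) \<and>
        ennreal L = (\<integral>\<^sup>+t\<in>I. ennreal (f (\<gamma> t) * norm (\<gamma>' t)) \<partial>lborel)"
      by (intro exI conjI, rule reg, rule nn_integral_regular_parametrization_line[OF assms reg, symmetric])
  qed (use nn_integral_regular_parametrization_line[OF assms] in blast)
qed

section \<open>The double Gaussian density as a product\<close>

lemma double_gaussian_eq:
  assumes "a > 0"
  shows "double_gaussian a (x, y)
    = (normal_density 1 a x + normal_density (- 1) a x) / 2 * normal_density 0 a y"
proof -
  \<comment> \<open>The product of the two normalizing constants; with the factor 2 of the average
    it becomes \<open>4 * pi * a\<^sup>2\<close>.\<close>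
  have "sqrt (2 * pi * a\<^sup>2) * sqrt (2 * pi * a\<^sup>2) = 2 * pi * a\<^sup>2"
    by simp
  then show ?thesis
    using assms
    by (simp add: double_gaussian_def normal_density_def field_simps)
qed

lemma double_gaussian_nonneg: "0 \<le> double_gaussian a q"
  by (cases q) (auto simp: double_gaussian_def)

lemma continuous_on_normal_density: "a > 0 \<Longrightarrow> continuous_on S (normal_density \<mu> a)"
  unfolding normal_density_def[abs_def] by (intro continuous_intros) auto

lemma has_integral_normal_density:
  "a > 0 \<Longrightarrow> (normal_density \<mu> a has_integral 1) UNIV"
  using has_integral_integral_lborel[OF integrable_normal_density] by simp

section \<open>Perimeters of vertical and horizontal lines\<close>

lemma weighted_perimeter_vertical_line:
  assumes "a > 0"
  shows "weighted_perimeter (double_gaussian a) (vertical_line b)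
    = ennreal ((normal_density 1 a b + normal_density (- 1) a b) / 2)"
proof -
  have "vertical_line b = range (\<lambda>s. (b, 0) + s *\<^sub>R (0, 1))"
    by (auto simp: vertical_line_def)
  moreover have "((\<lambda>s. double_gaussian a ((b, 0) + s *\<^sub>R (0, 1))) has_integral
      (normal_density 1 a b + normal_density (- 1) a b) / 2 * 1) UNIV"
    using has_integral_mult_right[OF has_integral_normal_density[OF assms, of 0],
        of "(normal_density 1 a b + normal_density (- 1) a b) / 2"]
    by (simp add: double_gaussian_eq[OF assms])
  ultimately show ?thesis
    using weighted_perimeter_line[of "(0, 1)" "double_gaussian a" "(b, 0)"] double_gaussian_nonneg
    by (simp add: norm_Pair)
qed

lemma weighted_perimeter_horizontal_line:
  assumes "a > 0"
  shows "weighted_perimeter (double_gaussian a) (horizontal_line c) = ennreal (normal_density 0 a c)"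
proof -
  have "horizontal_line c = range (\<lambda>s. (0, c) + s *\<^sub>R (1, 0))"
    by (auto simp: horizontal_line_def)
  moreover have "((\<lambda>s. double_gaussian a ((0, c) + s *\<^sub>R (1, 0))) has_integral
      (1 + 1) / 2 * normal_density 0 a c) UNIV"
    unfolding scaleR_Pair add_Pair double_gaussian_eq[OF assms]
    using has_integral_mult_left[OF has_integral_divide[OF has_integral_add[OF
          has_integral_normal_density[OF assms, of 1] has_integral_normal_density[OF assms, of "- 1"]], of 2],
        of "normal_density 0 a c"]
    by simp
  ultimately show ?thesis
    using weighted_perimeter_line[of "(1, 0)" "double_gaussian a" "(0, c)"] double_gaussian_nonneg
    by (simp add: norm_Pair)
qed

section \<open>Weighted areas of product sets\<close>

lemma nn_integral_normal_density:
  assumes "a > 0"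
  shows "(\<integral>\<^sup>+x. ennreal (normal_density \<mu> a x) \<partial>lborel) = 1"
  using assms by (subst nn_integral_eq_integral) auto

lemma weighted_area_double_gaussian_Times:
  assumes a: "a > 0" and [measurable]: "S \<in> sets borel" "T \<in> sets borel"
  shows "weighted_area (double_gaussian a) (S \<times> T)
    = (\<integral>\<^sup>+x\<in>S. ennreal ((normal_density 1 a x + normal_density (- 1) a x) / 2) \<partial>lborel)
      * (\<integral>\<^sup>+y\<in>T. ennreal (normal_density 0 a y) \<partial>lborel)"
proof -
  define g where "g x = (normal_density 1 a x + normal_density (- 1) a x) / 2" for x
  have [measurable]: "g \<in> borel_measurable borel"
    unfolding g_def by measurable
  have "weighted_area (double_gaussian a) (S \<times> T)
      = (\<integral>\<^sup>+q. (case q of (x, y) \<Rightarrow> (ennreal (g x) * indicator S x) * (ennreal (normal_density 0 a y) * indicator T y))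
          \<partial>(lborel \<Otimes>\<^sub>M lborel))"
    unfolding weighted_area_def lborel_prod
    by (intro nn_integral_cong)
       (auto simp: double_gaussian_eq[OF a] g_def[symmetric] ennreal_mult'' indicator_def split: prod.split)
  also have "\<dots> = (\<integral>\<^sup>+x. (\<integral>\<^sup>+y. (ennreal (g x) * indicator S x) * (ennreal (normal_density 0 a y) * indicator T y) \<partial>lborel) \<partial>lborel)"
    by (subst lborel.nn_integral_fst[symmetric]) auto
  also have "\<dots> = (\<integral>\<^sup>+x. ennreal (g x) * indicator S x * (\<integral>\<^sup>+y. ennreal (normal_density 0 a y) * indicator T y \<partial>lborel) \<partial>lborel)"
    by (intro nn_integral_cong nn_integral_cmult) auto
  also have "\<dots> = (\<integral>\<^sup>+x. ennreal (g x) * indicator S x \<partial>lborel) * (\<integral>\<^sup>+y. ennreal (normal_density 0 a y) * indicator T y \<partial>lborel)"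
    by (intro nn_integral_multc) auto
  finally show ?thesis by (simp add: g_def)
qed

section \<open>The Gaussian distribution function\<close>

definition gaussian_cdf :: "real \<Rightarrow> real \<Rightarrow> real" where
  "gaussian_cdf a t = measure (density lborel (normal_density 0 a)) {..t}"

lemma gaussian_cdf_nonneg: "0 \<le> gaussian_cdf a t"
  by (simp add: gaussian_cdf_def)

lemma ennreal_gaussian_cdf:
  assumes "a > 0"
  shows "ennreal (gaussian_cdf a t) = (\<integral>\<^sup>+x\<in>{..t}. ennreal (normal_density 0 a x) \<partial>lborel)"
proof -
  interpret prob_space "density lborel (normal_density 0 a)"
    by (rule prob_space_normal_density) fact
  show ?thesis
    by (simp add: gaussian_cdf_def emeasure_eq_measure[symmetric] emeasure_density)
qed

text \<open>This makes the distribution function a constant plus an integral over a compact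
  interval, ready for the fundamental theorem of calculus.\<close>

lemma gaussian_cdf_diff:
  assumes "a > 0" "s \<le> t"
  shows "gaussian_cdf a t = gaussian_cdf a s + integral {s..t} (normal_density 0 a)"
proof -
  interpret prob_space "density lborel (normal_density 0 a)"
    by (rule prob_space_normal_density) fact
  have "normal_density 0 a integrable_on {s..t}"
    by (intro integrable_continuous_real continuous_on_normal_density assms)
  then have I: "(normal_density 0 a has_integral integral {s..t} (normal_density 0 a)) {s..t}"
    by (rule integrable_integral)
  \<comment> \<open>The sets \<open>{..s}\<close> and \<open>{s..t}\<close> overlap only in the null
    set \<open>{s}\<close>.\<close>
  have "ennreal (gaussian_cdf a t)
      = (\<integral>\<^sup>+x. ennreal (normal_density 0 a x) * indicator {..s} x
            + ennreal (normal_density 0 a x) * indicator {s..t} x \<partial>lborel)"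
    unfolding ennreal_gaussian_cdf[OF assms(1)]
    using assms(2) AE_lborel_singleton[of s]
    by (intro nn_integral_cong_AE) (auto simp: indicator_def elim!: eventually_mono)
  also have "\<dots> = ennreal (gaussian_cdf a s) + ennreal (integral {s..t} (normal_density 0 a))"
    by (subst nn_integral_add)
       (auto simp: ennreal_gaussian_cdf[OF assms(1)] nn_integral_has_integral_lebesgue'[OF _ I])
  also have "\<dots> = ennreal (gaussian_cdf a s + integral {s..t} (normal_density 0 a))"
    by (intro ennreal_plus[symmetric] gaussian_cdf_nonneg has_integral_nonneg[OF I]) auto
  finally show ?thesis
    by (subst (asm) ennreal_inj) (auto intro!: add_nonneg_nonneg gaussian_cdf_nonneg has_integral_nonneg[OF I])
qed

lemma DERIV_gaussian_cdf:
  assumes "a > 0"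
  shows "(gaussian_cdf a has_real_derivative normal_density 0 a t) (at t)"
proof -
  \<comment> \<open>The base point \<open>t - 1\<close> is just some point to the left of
    \<open>t\<close>, so that the decomposition holds in a neighbourhood of
    \<open>t\<close>.\<close>
  have "((\<lambda>u. gaussian_cdf a (t - 1) + integral {t - 1..u} (normal_density 0 a))
      has_real_derivative 0 + normal_density 0 a t) (at t within {t - 1..t + 1})"
    by (intro derivative_intros integral_has_real_derivative continuous_on_normal_density assms) auto
  then have "((\<lambda>u. gaussian_cdf a (t - 1) + integral {t - 1..u} (normal_density 0 a))
      has_real_derivative normal_density 0 a t) (at t)"
    by (simp add: at_within_Icc_at)
  then show ?thesis
  proof (rule DERIV_cong_ev[THEN iffD1, rotated -1])
    show "\<forall>\<^sub>F u in nhds t. gaussian_cdf a (t - 1) + integral {t - 1..u} (normal_density 0 a) = gaussian_cdf a u"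
      by (rule eventually_mono[OF eventually_nhds_in_open[of "{t - 1<..}" t]])
         (auto intro!: gaussian_cdf_diff[OF assms, symmetric])
  qed auto
qed

text \<open>Divided by the derivative of \<open>gaussian_cdf a\<close>, this is
  \<open>- t / a\<^sup>2\<close>, the slope of the isoperimetric profile. It strictly decreases in
  \<open>t\<close>, which is the strict concavity.\<close>

lemma DERIV_normal_density:
  assumes "a > 0"
  shows "(normal_density 0 a has_real_derivative - (t / a\<^sup>2) * normal_density 0 a t) (at t)"
  unfolding normal_density_def[abs_def]
  using assms by (auto intro!: derivative_eq_intros simp: field_simps power2_eq_square)

text \<open>With \<open>F = gaussian_cdf a\<close> and \<open>I\<close> the function with \<open>I (F t) = normal_density 0 a t\<close>, this says that
  \<open>I\<close> lies strictly below its tangent at \<open>F c\<close>, whose slope is \<open>- c / a\<^sup>2\<close>.\<close>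

lemma normal_density_tangent:
  assumes a: "a > 0" and "t \<noteq> c"
  shows "normal_density 0 a t + c / a\<^sup>2 * gaussian_cdf a t
    < normal_density 0 a c + c / a\<^sup>2 * gaussian_cdf a c"
proof -
  define h where "h t = normal_density 0 a t + c / a\<^sup>2 * gaussian_cdf a t" for t
  \<comment> \<open>The two derivatives share the positive factor
    \<open>normal_density 0 a x\<close>, so the sign is that of \<open>c - x\<close>:
    \<open>h\<close> increases strictly up to \<open>c\<close> and decreases strictly after
    it.\<close>
  have dh: "(h has_real_derivative (c - x) / a\<^sup>2 * normal_density 0 a x) (at x)" for x
    unfolding h_def
    using a by (auto intro!: derivative_eq_intros DERIV_normal_density DERIV_gaussian_cdf simp: field_simps)
  have cont: "continuous_on S h" for S
    using dh by (meson DERIV_isCont continuous_at_imp_continuous_on)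
  note pos = normal_density_pos[OF a, of 0]
  consider "t < c" | "c < t" using \<open>t \<noteq> c\<close> by linarith
  then have "h t < h c"
  proof cases
    case 1
    then show ?thesis
    proof (rule DERIV_pos_imp_increasing_open[OF _ _ cont])
      fix x assume "x < c"
      then show "\<exists>y. (h has_real_derivative y) (at x) \<and> 0 < y"
        using dh[of x] a pos[of x] by (intro exI[of _ "(c - x) / a\<^sup>2 * normal_density 0 a x"]) auto
    qed
  next
    case 2
    then show ?thesis
    proof (rule DERIV_neg_imp_decreasing_open[OF _ _ cont])
      fix x assume "c < x"
      then show "\<exists>y. (h has_real_derivative y) (at x) \<and> y < 0"
        using dh[of x] a pos[of x]
        by (intro exI[of _ "(c - x) / a\<^sup>2 * normal_density 0 a x"]) (auto intro!: mult_neg_pos divide_neg_pos)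
    qed
  qed
  then show ?thesis by (simp add: h_def)
qed

section \<open>Areas of half-planes\<close>

lemma half_line_cases:
  fixes v d b :: real
  assumes "v \<noteq> 0" "v * b = d"
  shows "{x. v * x \<le> d} = {..b} \<or> {x. v * x \<le> d} = {b..}"
    and "{x. v * x < d} = {..<b} \<or> {x. v * x < d} = {b<..}"
  using assms by (cases "v > 0"; force)+

lemma half_plane_vertical:
  assumes "half_plane_bounded_by H (vertical_line b)"
  obtains S where "S \<in> {{..b}, {b..}, {..<b}, {b<..}}" "H = S \<times> UNIV"
proof -
  obtain v1 v2 d where v: "(v1, v2) \<noteq> 0"
    and H: "H = {p. (v1, v2) \<bullet> p \<le> d} \<or> H = {p. (v1, v2) \<bullet> p < d}"
    and fr: "frontier H = vertical_line b"
    using assms unfolding half_plane_bounded_by_def split_paired_Ex by blast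
  have "frontier H = {p. (v1, v2) \<bullet> p = d}"
    using H v frontier_halfspace_le frontier_halfspace_lt by blast
  \<comment> \<open>Two points of the line determine the normal vector: subtracting their equations
    gives \<open>v2 = 0\<close>.\<close>
  moreover have "(b, 0) \<in> frontier H" "(b, 1) \<in> frontier H"
    unfolding fr by (auto simp: vertical_line_def)
  ultimately have v': "v2 = 0" "v1 * b = d" "v1 \<noteq> 0"
    using v by (auto simp: zero_prod_def)
  have "H = {x. v1 * x \<le> d} \<times> UNIV \<or> H = {x. v1 * x < d} \<times> UNIV"
    using H v' by auto
  then show ?thesis
    using half_line_cases[OF v'(3,2)] that by (elim disjE) auto
qed

lemma half_plane_horizontal:
  assumes "half_plane_bounded_by H (horizontal_line c)"
  obtains S where "S \<in> {{..c}, {c..}, {..<c}, {c<..}}" "H = UNIV \<times> S"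
proof -
  obtain v1 v2 d where v: "(v1, v2) \<noteq> 0"
    and H: "H = {p. (v1, v2) \<bullet> p \<le> d} \<or> H = {p. (v1, v2) \<bullet> p < d}"
    and fr: "frontier H = horizontal_line c"
    using assms unfolding half_plane_bounded_by_def split_paired_Ex by blast
  have "frontier H = {p. (v1, v2) \<bullet> p = d}"
    using H v frontier_halfspace_le frontier_halfspace_lt by blast
  moreover have "(0, c) \<in> frontier H" "(1, c) \<in> frontier H"
    unfolding fr by (auto simp: horizontal_line_def)
  ultimately have v': "v1 = 0" "v2 * c = d" "v2 \<noteq> 0"
    using v by (auto simp: zero_prod_def)
  have "H = UNIV \<times> {x. v2 * x \<le> d} \<or> H = UNIV \<times> {x. v2 * x < d}"
    using H v' by auto
  then show ?thesis
    using half_line_cases[OF v'(3,2)] that by (elim disjE) auto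
qed

lemma nn_integral_normal_density_half_line:
  assumes a: "a > 0"
  shows "(\<integral>\<^sup>+x\<in>{..b}. ennreal (normal_density \<mu> a x) \<partial>lborel) = ennreal (gaussian_cdf a (b - \<mu>))"
    and "(\<integral>\<^sup>+x\<in>{b..}. ennreal (normal_density \<mu> a x) \<partial>lborel) = ennreal (gaussian_cdf a (\<mu> - b))"
proof -
  show "(\<integral>\<^sup>+x\<in>{..b}. ennreal (normal_density \<mu> a x) \<partial>lborel) = ennreal (gaussian_cdf a (b - \<mu>))"
    unfolding ennreal_gaussian_cdf[OF a]
    \<comment> \<open>Translation by the mean.\<close>
    by (subst nn_integral_real_affine[where c = 1 and t = \<mu>])
       (auto simp: normal_density_def indicator_def intro!: nn_integral_cong)
  show "(\<integral>\<^sup>+x\<in>{b..}. ennreal (normal_density \<mu> a x) \<partial>lborel) = ennreal (gaussian_cdf a (\<mu> - b))"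
    unfolding ennreal_gaussian_cdf[OF a]
    \<comment> \<open>Reflection \<open>x \<mapsto> \<mu> - x\<close>, using that the centered
      density is even.\<close>
    by (subst nn_integral_real_affine[where c = "- 1" and t = \<mu>])
       (auto simp: normal_density_def indicator_def intro!: nn_integral_cong)
qed

lemma nn_integral_open_half_line:
  fixes g :: "real \<Rightarrow> ennreal"
  shows "(\<integral>\<^sup>+x\<in>{..<b}. g x \<partial>lborel) = (\<integral>\<^sup>+x\<in>{..b}. g x \<partial>lborel)"
    and "(\<integral>\<^sup>+x\<in>{b<..}. g x \<partial>lborel) = (\<integral>\<^sup>+x\<in>{b..}. g x \<partial>lborel)"
  using AE_lborel_singleton[of b]
  by (auto simp: indicator_def elim!: eventually_mono intro!: nn_integral_cong_AE)

lemma nn_integral_half_line_cases: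
  fixes g :: "real \<Rightarrow> ennreal"
  assumes S: "S \<in> {{..b}, {b..}, {..<b}, {b<..}}"
  shows "(\<integral>\<^sup>+x\<in>S. g x \<partial>lborel) = (\<integral>\<^sup>+x\<in>{..b}. g x \<partial>lborel)
    \<or> (\<integral>\<^sup>+x\<in>S. g x \<partial>lborel) = (\<integral>\<^sup>+x\<in>{b..}. g x \<partial>lborel)"
  using S by (auto simp: nn_integral_open_half_line)

lemma nn_integral_average_normal_density:
  assumes [measurable]: "S \<in> sets borel"
  shows "(\<integral>\<^sup>+x\<in>S. ennreal ((normal_density \<mu> a x + normal_density \<nu> a x) / 2) \<partial>lborel)
    = ((\<integral>\<^sup>+x\<in>S. ennreal (normal_density \<mu> a x) \<partial>lborel)
      + (\<integral>\<^sup>+x\<in>S. ennreal (normal_density \<nu> a x) \<partial>lborel)) / 2"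
proof -
  have "ennreal ((normal_density \<mu> a x + normal_density \<nu> a x) / 2) * indicator S x
      = (ennreal (normal_density \<mu> a x) * indicator S x + ennreal (normal_density \<nu> a x) * indicator S x) / 2" for x
    by (simp add: indicator_def ennreal_plus divide_ennreal[symmetric] del: ennreal_plus[symmetric])
  then show ?thesis
    by (simp add: nn_integral_divide nn_integral_add)
qed

text \<open>By the symmetry of the density in \<open>x\<close>, a right half-plane at
  \<open>b\<close> has the area of the left one at \<open>- b\<close>; \<open>b'\<close> absorbs
  this reflection.\<close>

lemma area_vertical_half_plane:
  assumes a: "a > 0" and H: "half_plane_bounded_by H (vertical_line b)"
  obtains b' where "b' = b \<or> b' = - b"
    "weighted_area (double_gaussian a) H
      = ennreal ((gaussian_cdf a (b' - 1) + gaussian_cdf a (b' + 1)) / 2)"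
proof -
  obtain S where S: "S \<in> {{..b}, {b..}, {..<b}, {b<..}}" and HS: "H = S \<times> UNIV"
    using half_plane_vertical[OF H] by blast
  have [measurable]: "S \<in> sets borel" using S by auto
  let ?g = "\<lambda>x. ennreal ((normal_density 1 a x + normal_density (- 1) a x) / 2)"
  have avg: "(ennreal x + ennreal y) / 2 = ennreal ((x + y) / 2)" if "0 \<le> x" "0 \<le> y" for x y
    using that by (simp add: divide_ennreal[symmetric])
  have "weighted_area (double_gaussian a) H = (\<integral>\<^sup>+x\<in>S. ?g x \<partial>lborel)"
    unfolding HS by (simp add: weighted_area_double_gaussian_Times[OF a] nn_integral_normal_density[OF a])
  moreover have "(\<integral>\<^sup>+x\<in>{..b}. ?g x \<partial>lborel) = ennreal ((gaussian_cdf a (b - 1) + gaussian_cdf a (b + 1)) / 2)"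
    by (simp add: nn_integral_average_normal_density nn_integral_normal_density_half_line[OF a] avg gaussian_cdf_nonneg)
  moreover have "(\<integral>\<^sup>+x\<in>{b..}. ?g x \<partial>lborel) = ennreal ((gaussian_cdf a (- b - 1) + gaussian_cdf a (- b + 1)) / 2)"
    by (simp add: nn_integral_average_normal_density nn_integral_normal_density_half_line[OF a] avg gaussian_cdf_nonneg
        add.commute minus_diff_commute)
  ultimately show ?thesis
    using nn_integral_half_line_cases[OF S, of ?g] that[of b] that[of "- b"] by auto
qed

lemma area_horizontal_half_plane:
  assumes a: "a > 0" and H: "half_plane_bounded_by H (horizontal_line c)"
  obtains c' where "c' = c \<or> c' = - c"
    "weighted_area (double_gaussian a) H = ennreal (gaussian_cdf a c')"
proof -
  obtain S where S: "S \<in> {{..c}, {c..}, {..<c}, {c<..}}" and HS: "H = UNIV \<times> S"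
    using half_plane_horizontal[OF H] by blast
  have [measurable]: "S \<in> sets borel" using S by auto
  let ?g = "\<lambda>x. ennreal (normal_density 0 a x)"
  have "(\<integral>\<^sup>+x\<in>UNIV. ennreal ((normal_density 1 a x + normal_density (- 1) a x) / 2) \<partial>lborel) = 1"
    by (subst nn_integral_average_normal_density) (auto simp: nn_integral_normal_density[OF a])
  then have "weighted_area (double_gaussian a) H = (\<integral>\<^sup>+x\<in>S. ?g x \<partial>lborel)"
    unfolding HS by (simp add: weighted_area_double_gaussian_Times[OF a])
  then show ?thesis
    using nn_integral_half_line_cases[OF S, of ?g] that
      nn_integral_normal_density_half_line[OF a, where b = c and \<mu> = 0] by auto
qed

section \<open>Comparison of the two perimeters at equal area\<close>

theorem proposition4p5:
  fixes a A b c :: real and Hv Hh :: "(real \<times> real) set"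
  assumes "a > 0"
    and "0 < A" and "A < 1"
    and "half_plane_bounded_by Hv (vertical_line b)"
    and "half_plane_bounded_by Hh (horizontal_line c)"
    and "weighted_area (double_gaussian a) Hv = ennreal A"
    and "weighted_area (double_gaussian a) Hh = ennreal A"
  shows "weighted_perimeter (double_gaussian a) (vertical_line b)
       < weighted_perimeter (double_gaussian a) (horizontal_line c)"
proof -
  obtain b' where b': "b' = b \<or> b' = - b"
    and Av: "ennreal A = ennreal ((gaussian_cdf a (b' - 1) + gaussian_cdf a (b' + 1)) / 2)"
    using area_vertical_half_plane[OF \<open>a > 0\<close> assms(4)] assms(6) by metis
  obtain c' where c': "c' = c \<or> c' = - c" and Ah: "ennreal A = ennreal (gaussian_cdf a c')"
    using area_horizontal_half_plane[OF \<open>a > 0\<close> assms(5)] assms(7) by metis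
  have area: "(gaussian_cdf a (b' - 1) + gaussian_cdf a (b' + 1)) / 2 = gaussian_cdf a c'"
    using Av Ah by (simp add: gaussian_cdf_nonneg)
  let ?h = "\<lambda>t. normal_density 0 a t + c' / a\<^sup>2 * gaussian_cdf a t"
  have strict: "?h t < ?h c'" if "t \<noteq> c'" for t
    using normal_density_tangent[OF \<open>a > 0\<close> that] .
  then have le: "?h t \<le> ?h c'" for t
    by (cases "t = c'") (auto intro: less_imp_le)
  \<comment> \<open>The two points differ by 2, so at least one of the two tangent inequalities is
    strict.\<close>
  have "b' - 1 \<noteq> c' \<or> b' + 1 \<noteq> c'"
    by auto
  then have "?h (b' - 1) + ?h (b' + 1) < ?h c' + ?h c'"
    using strict le by (meson add_le_less_mono add_less_le_mono)
  \<comment> \<open>Equality of the areas makes the linear terms of the summed tangent inequalities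
    cancel, leaving only the densities.\<close>
  moreover have "c' / a\<^sup>2 * gaussian_cdf a (b' - 1) + c' / a\<^sup>2 * gaussian_cdf a (b' + 1)
      = c' / a\<^sup>2 * gaussian_cdf a c' + c' / a\<^sup>2 * gaussian_cdf a c'"
    unfolding area[symmetric] by (simp add: algebra_simps add_divide_distrib)
  ultimately have "(normal_density 0 a (b' - 1) + normal_density 0 a (b' + 1)) / 2 < normal_density 0 a c'"
    by simp
  \<comment> \<open>Reflecting \<open>b\<close> merely swaps the two summands, since the centered
    density is even.\<close>
  moreover have "normal_density 0 a (b' - 1) + normal_density 0 a (b' + 1)
      = normal_density 1 a b + normal_density (- 1) a b"
    using b' by (auto simp: normal_density_def power2_eq_square algebra_simps)
  moreover have "normal_density 0 a c' = normal_density 0 a c"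
    using c' by (auto simp: normal_density_def)
  ultimately show ?thesis
    using \<open>a > 0\<close>
    by (simp add: weighted_perimeter_vertical_line weighted_perimeter_horizontal_line
        ennreal_less_iff add_nonneg_nonneg)
qed

end
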